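(* The function $f$ is dual relatively smooth with respect to $\phi$ with constant $L=1$, that is, $$D_{\phi^*}(\xi,\eta)\le D_{f^*}(\xi,\eta)\qquad\text{for all }\xi,\eta\in\{\nabla f(v):v\in\mathbb R^m\}.$$
   Context: Setting. Fix positive integers $n,m$, vectors $a\in\mathbb R^n$, $b\in\mathbb R^m$ with strictly positive entries and $\sum_i a_i=\sum_j b_j=1$, and a matrix $C\in\mathbb R^{n\times m}$ with nonnegative entries. For $u\in\mathbb R^n,v\in\mathbb R^m$ let $P_{ij}(u,v)=\exp(u_i+v_j-C_{ij})$ and $F(u,v)=\sum_{i,j}P_{ij}(u,v)-\langle u,a\rangle-\langle v,b\rangle$. For each $v$, $u(v)$ is the unique minimizer of $F(\cdot,v)$, i.e. $u_i(v)=\log a_i-\log\sum_j e^{v_j-C_{ij}}$, and $f(v):=F(u(v),v)$, $f:\mathbb R^m\to\mathbb R$ (convex and smooth). One has $\nabla f(v)=c_P-b$, where $c_P$ is the vector of column sums of $P(u(v),v)$; in particular every $\nabla f(v)$ has coordinate sum $0$ and entries $>-b_j$. Mirror function: $\phi(v)=\sum_{j=1}^m b_j(e^{v_j}-v_j)$, with Fenchel conjugate $\phi^*$, $\nabla\phi^*(\xi)_j=\log(1+\xi_j/b_j)$ and $\nabla^2\phi^*(\xi)=\mathrm{diag}(b+\xi)^{-1}$ for $\xi_j>-b_j$. $D_{\phi^*}(\xi,\eta)=\phi^*(\xi)-\phi^*(\eta)-\langle\nabla\phi^*(\eta),\xi-\eta\rangle$. $f^*$ is the Fenchel conjugate of $f$.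 For $\xi=\nabla f(v)$ and $\eta=\nabla f(w)$, $D_{f^*}(\xi,\eta):=f^*(\xi)-f^*(\eta)-\langle w,\xi-\eta\rangle$; since $w$ is determined by $\eta$ up to adding multiples of $\mathbf 1$, and $\langle\mathbf 1,\xi-\eta\rangle=0$, this is well defined. *)

theory Defs
  imports "HOL-Analysis.Analysis"
begin

definition gradient :: "('a::real_inner \<Rightarrow> real) \<Rightarrow> 'a \<Rightarrow> 'a" where
  "gradient h x = (THE D. GDERIV h x :> D)"

lemma gradient_eqI: "GDERIV h x :> D \<Longrightarrow> gradient h x = D"
proof -
  assume D: "GDERIV h x :> D"
  have "E = D" if "GDERIV h x :> E" for E
  proof -
    have "(\<lambda>y. inner y E) = (\<lambda>y. inner y D)"
      using has_derivative_unique D that unfolding gderiv_def by blast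
    then have "inner (E - D) E = inner (E - D) D"
      by metis
    then have "inner (E - D) (E - D) = 0"
      by (simp add: inner_diff_right)
    then show ?thesis by simp
  qed
  with D show "gradient h x = D"
    unfolding gradient_def by (intro the_equality)
qed

definition fenchel_conj :: "('a::real_inner \<Rightarrow> real) \<Rightarrow> 'a \<Rightarrow> ereal" where
  "fenchel_conj h \<xi> = (SUP v. ereal (\<xi> \<bullet> v - h v))"

text \<open>
  The Bregman distance of \<open>g\<close>, with a (sub)gradient \<open>p\<close> of \<open>g\<close> at \<open>\<eta>\<close> as a separate argument. For
  \<open>g = fenchel_conj (semi_dual a b C)\<close> it cannot be recovered as a gradient: this \<open>g\<close> is finite only
  on vectors with coordinate sum 0, so it is nowhere differentiable. There \<open>p\<close> is a point \<open>w\<close> with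
  \<open>gradient (semi_dual a b C) w = \<eta>\<close>; such \<open>w\<close> differ by multiples of the all-ones vector, which is
  orthogonal to \<open>\<xi> - \<eta>\<close>.
\<close>

definition bregman_at :: "('a::real_inner \<Rightarrow> ereal) \<Rightarrow> 'a \<Rightarrow> 'a \<Rightarrow> 'a \<Rightarrow> ereal" where
  "bregman_at g p \<xi> \<eta> = g \<xi> - g \<eta> - ereal (p \<bullet> (\<xi> - \<eta>))"

text \<open>
  The conjugate is extended-real valued; its gradient is taken after \<open>real_of_ereal\<close>, which is
  harmless at interior points of its effective domain.
\<close>

definition bregman :: "('a::real_inner \<Rightarrow> ereal) \<Rightarrow> 'a \<Rightarrow> 'a \<Rightarrow> ereal" where
  "bregman g \<xi> \<eta> = bregman_at g (gradient (\<lambda>x. real_of_ereal (g x)) \<eta>) \<xi> \<eta>"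

definition plan :: "real^'m^'n \<Rightarrow> real^'n \<Rightarrow> real^'m \<Rightarrow> real^'m^'n" where
  "plan C u v = (\<chi> i j. exp (u $ i + v $ j - C $ i $ j))"

definition dual_obj ::
    "real^'n \<Rightarrow> real^'m \<Rightarrow> real^'m^'n \<Rightarrow> real^'n \<Rightarrow> real^'m \<Rightarrow> real" where
  "dual_obj a b C u v = (\<Sum>i\<in>UNIV. \<Sum>j\<in>UNIV. plan C u v $ i $ j) - u \<bullet> a - v \<bullet> b"

definition opt_u :: "real^'n \<Rightarrow> real^'m \<Rightarrow> real^'m^'n \<Rightarrow> real^'m \<Rightarrow> real^'n" where
  "opt_u a b C v = (THE u. \<forall>u'. dual_obj a b C u v \<le> dual_obj a b C u' v)"

definition semi_dual :: "real^'n \<Rightarrow> real^'m \<Rightarrow> real^'m^'n \<Rightarrow> real^'m \<Rightarrow> real" where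
  "semi_dual a b C v = dual_obj a b C (opt_u a b C v) v"

definition mirror :: "real^'m \<Rightarrow> real^'m \<Rightarrow> real" where
  "mirror b v = (\<Sum>j\<in>UNIV. b $ j * (exp (v $ j) - v $ j))"

lemma opt_u_eq:
  fixes a :: "real^'n" and b :: "real^'m"
  assumes a: "\<And>i. a $ i > 0"
  shows "opt_u a b C v = (\<chi> i. ln (a $ i) - ln (\<Sum>j\<in>UNIV. exp (v $ j - C $ i $ j)))"
proof -
  define S where "S i = (\<Sum>j\<in>UNIV. exp (v $ j - C $ i $ j))" for i
  define z where "z = (\<chi> i. ln (a $ i) - ln (S i))"
  define g where "g i x = exp x * S i - x * a $ i" for i x
  have S: "S i > 0" for i
    unfolding S_def by (intro sum_pos) auto
  have row: "(\<Sum>j\<in>UNIV. exp (u $ i + v $ j - C $ i $ j)) = exp (u $ i) * S i"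
    for u :: "real^'n" and i
    unfolding S_def sum_distrib_left by (simp add: exp_add[symmetric] add_diff_eq)
  have F: "dual_obj a b C u v = (\<Sum>i\<in>UNIV. g i (u $ i)) - v \<bullet> b" for u
    by (simp add: dual_obj_def plan_def row g_def inner_vec_def[of u a] sum_subtractf)
  have val: "exp (z $ i) * S i = a $ i" for i
    using a[of i] S[of i] by (simp add: z_def exp_diff)
  have gx: "g i x - g i (z $ i) = a $ i * (exp (x - z $ i) - (1 + (x - z $ i)))" for i x
  proof -
    have "exp x * S i = exp (x - z $ i) * (exp (z $ i) * S i)"
      by (simp add: mult.assoc[symmetric] exp_add[symmetric])
    then show ?thesis
      unfolding g_def val by (simp add: algebra_simps)
  qed
  have less: "g i (z $ i) < g i x" if "x \<noteq> z $ i" for i x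
  proof -
    have "1 + (x - z $ i) < exp (x - z $ i)"
      using that exp_minus_greater[of "z $ i - x"] by simp
    then have "0 < a $ i * (exp (x - z $ i) - (1 + (x - z $ i)))"
      using a[of i] by (intro mult_pos_pos) auto
    then show ?thesis using gx[of i x] by linarith
  qed
  then have le: "g i (z $ i) \<le> g i x" for i x
    by (metis less_eq_real_def)
  have "opt_u a b C v = z"
    unfolding opt_u_def
  proof (rule the_equality)
    show "\<forall>u'. dual_obj a b C z v \<le> dual_obj a b C u' v"
      unfolding F by (intro allI diff_right_mono sum_mono le)
  next
    fix w assume w: "\<forall>u'. dual_obj a b C w v \<le> dual_obj a b C u' v"
    show "w = z"
    proof (rule ccontr)
      assume "w \<noteq> z"
      then obtain k where k: "w $ k \<noteq> z $ k"
        unfolding vec_eq_iff by blast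
      have "(\<Sum>i\<in>UNIV. g i (z $ i)) < (\<Sum>i\<in>UNIV. g i (w $ i))"
        using le less[OF k] by (intro sum_strict_mono_ex1) auto
      moreover have "dual_obj a b C w v \<le> dual_obj a b C z v"
        using w by blast
      ultimately show False unfolding F by linarith
    qed
  qed
  then show ?thesis
    unfolding z_def S_def .
qed

end

theory Submission
  imports Defs
begin

text \<open>
  Let \<open>p\<^sub>i(v)\<close> be the softmax of the vector \<open>v - C\<^sub>i\<close>, so that \<open>\<nabla>f(v) + b = c(v) = \<Sum>\<^sub>i a\<^sub>i p\<^sub>i(v)\<close>.
  For \<open>\<xi> = \<nabla>f(v)\<close> and \<open>\<eta> = \<nabla>f(w)\<close>, the left side is the Kullback-Leibler divergence
  \<open>KL(c(v), c(w))\<close>, while the right side is the Bregman distance \<open>D\<^sub>f(w, v)\<close> with the arguments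
  swapped, which equals \<open>\<Sum>\<^sub>i a\<^sub>i KL(p\<^sub>i(v), p\<^sub>i(w))\<close>. The claim is thus the joint convexity of
  the divergence, that is, the log-sum inequality.
\<close>

section \<open>Conjugates at subgradients and the log-sum inequality\<close>

text \<open>The subgradient inequality at \<open>x\<close> rearranges to say that \<open>x\<close>
  attains the supremum (equality in Fenchel-Young). Both conjugates are evaluated this way.\<close>

lemma fenchel_conj_subgradient:
  assumes "\<And>z. h x + \<xi> \<bullet> (z - x) \<le> h z"
  shows "fenchel_conj h \<xi> = ereal (\<xi> \<bullet> x - h x)"
  unfolding fenchel_conj_def
proof (rule antisym)
  show "(SUP v. ereal (\<xi> \<bullet> v - h v)) \<le> ereal (\<xi> \<bullet> x - h x)"
  proof (rule SUP_least)
    fix v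
    show "ereal (\<xi> \<bullet> v - h v) \<le> ereal (\<xi> \<bullet> x - h x)"
      using assms[of v] by (simp add: inner_diff_right)
  qed
qed (rule SUP_upper, simp)

text \<open>Each term is bounded through \<open>ln t \<le> t - 1\<close>, with \<open>t\<close> the
  ratio of the totals divided by the ratio of the summands; the resulting linear bounds add up to
  zero.\<close>

lemma log_sum_inequality:
  fixes x y :: "'i \<Rightarrow> real"
  assumes "finite I" "I \<noteq> {}" and x: "\<And>i. i \<in> I \<Longrightarrow> x i > 0" and y: "\<And>i. i \<in> I \<Longrightarrow> y i > 0"
  shows "sum x I * ln (sum x I / sum y I) \<le> (\<Sum>i\<in>I. x i * ln (x i / y i))"
proof -
  let ?X = "sum x I" and ?Y = "sum y I"
  have X: "?X > 0" and Y: "?Y > 0"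
    using assms by (auto intro: sum_pos)
  have "x i * ln (?X / ?Y) - x i * ln (x i / y i) \<le> ?X / ?Y * y i - x i" if "i \<in> I" for i
  proof -
    let ?t = "(?X / ?Y) / (x i / y i)"
    have "ln ?t \<le> ?t - 1"
      using X Y x[OF that] y[OF that] by (intro ln_le_minus_one) auto
    then have "x i * ln ?t \<le> x i * (?t - 1)"
      using x[OF that] by (intro mult_left_mono) auto
    moreover have "ln ?t = ln (?X / ?Y) - ln (x i / y i)"
      using X Y x[OF that] y[OF that] by (intro ln_divide_pos) auto
    moreover have "x i * (?t - 1) = ?X / ?Y * y i - x i"
      using x[OF that] by (simp add: right_diff_distrib)
    ultimately show ?thesis
      by (simp add: right_diff_distrib)
  qed
  then have "(\<Sum>i\<in>I. x i * ln (?X / ?Y) - x i * ln (x i / y i)) \<le> (\<Sum>i\<in>I. ?X / ?Y * y i - x i)"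
    by (rule sum_mono)
  also have "\<dots> = 0"
    unfolding sum_subtractf sum_distrib_left[symmetric] using Y by simp
  finally show ?thesis
    by (simp add: sum_subtractf sum_distrib_right)
qed

section \<open>The mirror function, its conjugate and Bregman distance\<close>

text \<open>The point \<open>x\<close> solves \<open>b $ j * (exp (x $ j) - 1) = \<xi> $ j\<close>,
  so \<open>\<xi>\<close> is the gradient of the mirror function there, and each coordinate lies
  above its tangent by convexity of \<open>exp\<close>.\<close>

lemma mirror_subgradient:
  fixes b \<xi> z :: "real^'m"
  assumes b: "\<And>j. b $ j > 0" and \<xi>: "\<And>j. - b $ j < \<xi> $ j"
  defines "x \<equiv> \<chi> j. ln ((b $ j + \<xi> $ j) / b $ j)"
  shows "mirror b x + \<xi> \<bullet> (z - x) \<le> mirror b z"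
proof -
  have "b $ j * (exp (x $ j) - x $ j) + \<xi> $ j * (z $ j - x $ j) \<le> b $ j * (exp (z $ j) - z $ j)" for j
  proof -
    have pos: "b $ j + \<xi> $ j > 0"
      using \<xi>[of j] by simp
    then have ex: "b $ j * exp (x $ j) = b $ j + \<xi> $ j"
      using b[of j] by (simp add: x_def)
    have ez: "b $ j * exp (z $ j) = (b $ j + \<xi> $ j) * exp (z $ j - x $ j)"
      by (simp add: ex[symmetric] mult.assoc exp_add[symmetric])
    have "(b $ j + \<xi> $ j) * (1 + (z $ j - x $ j)) \<le> (b $ j + \<xi> $ j) * exp (z $ j - x $ j)"
      using pos by (intro mult_left_mono exp_ge_add_one_self) auto
    then show ?thesis
      unfolding right_diff_distrib ex ez by (simp add: algebra_simps)
  qed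
  then show ?thesis
    unfolding mirror_def inner_vec_def
    by (simp add: sum.distrib[symmetric]) (rule sum_mono, simp)
qed

text \<open>With \<open>c = b + \<xi>\<close>, the value is the generalized Kullback-Leibler
  divergence of \<open>c\<close> from \<open>b\<close>, less the total of \<open>b\<close>.\<close>

lemma fenchel_conj_mirror:
  fixes b \<xi> :: "real^'m"
  assumes b: "\<And>j. b $ j > 0" and \<xi>: "\<And>j. - b $ j < \<xi> $ j"
  shows "fenchel_conj (mirror b) \<xi>
    = ereal (\<Sum>j\<in>UNIV. (b $ j + \<xi> $ j) * ln ((b $ j + \<xi> $ j) / b $ j) - (b $ j + \<xi> $ j))"
proof -
  have "b $ j * exp (ln ((b $ j + \<xi> $ j) / b $ j)) = b $ j + \<xi> $ j" for j
    using b[of j] \<xi>[of j] by simp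
  then show ?thesis
    unfolding fenchel_conj_subgradient[OF mirror_subgradient[OF assms]]
    by (simp add: mirror_def inner_vec_def sum_subtractf[symmetric] algebra_simps)
qed

lemma gradient_fenchel_conj_mirror:
  fixes b \<eta> :: "real^'m"
  assumes b: "\<And>j. b $ j > 0" and \<eta>: "\<And>j. - b $ j < \<eta> $ j"
  shows "gradient (\<lambda>\<xi>. real_of_ereal (fenchel_conj (mirror b) \<xi>)) \<eta>
    = (\<chi> j. ln ((b $ j + \<eta> $ j) / b $ j))"
proof (rule gradient_eqI)
  let ?g = "\<lambda>\<xi>::real^'m. \<Sum>j\<in>UNIV. (b $ j + \<xi> $ j) * ln ((b $ j + \<xi> $ j) / b $ j) - (b $ j + \<xi> $ j)"
  let ?U = "{\<xi>::real^'m. \<forall>j. - b $ j < \<xi> $ j}"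
  \<comment> \<open>The closed form \<open>?g\<close> of the conjugate holds on \<open>?U\<close>;
    openness of \<open>?U\<close> lets the derivative of \<open>?g\<close> at \<open>\<eta>\<close>
    pass to the conjugate.\<close>
  have "?U = (\<Inter>j. {\<xi>. - b $ j < \<xi> $ j})"
    by auto
  then have "open ?U"
    by (auto intro!: open_INT open_Collect_less continuous_intros)
  have summand: "((\<lambda>\<xi>. (b $ j + \<xi> $ j) * ln ((b $ j + \<xi> $ j) / b $ j) - (b $ j + \<xi> $ j))
      has_derivative (\<lambda>h. h $ j * ln ((b $ j + \<eta> $ j) / b $ j))) (at \<eta>)" for j
  proof -
    have pos: "b $ j > 0" "b $ j + \<eta> $ j > 0"
      using b[of j] \<eta>[of j] by simp_all
    \<comment> \<open>The product rule contributes an extra 1, which the derivative of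
      \<open>- (b $ j + t)\<close> cancels.\<close>
    have "((\<lambda>t. (b $ j + t) * ln ((b $ j + t) / b $ j) - (b $ j + t))
        has_real_derivative ln ((b $ j + \<eta> $ j) / b $ j)) (at (\<eta> $ j))"
      using pos by (auto intro!: derivative_eq_intros)
    from has_derivative_compose[OF bounded_linear_imp_has_derivative[OF bounded_linear_vec_nth]
        this[unfolded has_field_derivative_def]]
    show ?thesis
      by (simp add: mult.commute)
  qed
  have "(?g has_derivative (\<lambda>h. \<Sum>j\<in>UNIV. h $ j * ln ((b $ j + \<eta> $ j) / b $ j))) (at \<eta>)"
    by (intro has_derivative_sum summand)
  then have "((\<lambda>\<xi>. real_of_ereal (fenchel_conj (mirror b) \<xi>)) has_derivative
      (\<lambda>h. \<Sum>j\<in>UNIV. h $ j * ln ((b $ j + \<eta> $ j) / b $ j))) (at \<eta>)"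
    by (rule has_derivative_transform_within_open[OF _ \<open>open ?U\<close>])
      (use \<eta> in \<open>auto simp: fenchel_conj_mirror[OF b]\<close>)
  then show "GDERIV (\<lambda>\<xi>. real_of_ereal (fenchel_conj (mirror b) \<xi>)) \<eta>
      :> (\<chi> j. ln ((b $ j + \<eta> $ j) / b $ j))"
    by (simp add: gderiv_def inner_vec_def)
qed

text \<open>Once the logarithms are split, the terms in \<open>ln (b $ j)\<close> cancel. What
  remains is the generalized divergence of \<open>b + \<xi>\<close> from
  \<open>b + \<eta>\<close>.\<close>

lemma bregman_fenchel_conj_mirror:
  fixes b \<xi> \<eta> :: "real^'m"
  assumes b: "\<And>j. b $ j > 0" and \<xi>: "\<And>j. - b $ j < \<xi> $ j" and \<eta>: "\<And>j. - b $ j < \<eta> $ j"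
  shows "bregman (fenchel_conj (mirror b)) \<xi> \<eta>
    = ereal (\<Sum>j\<in>UNIV. (b $ j + \<xi> $ j) * ln ((b $ j + \<xi> $ j) / (b $ j + \<eta> $ j)) - \<xi> $ j + \<eta> $ j)"
proof -
  have "(b $ j + \<xi> $ j) * ln ((b $ j + \<xi> $ j) / b $ j) - (b $ j + \<xi> $ j)
      - ((b $ j + \<eta> $ j) * ln ((b $ j + \<eta> $ j) / b $ j) - (b $ j + \<eta> $ j))
      - ln ((b $ j + \<eta> $ j) / b $ j) * (\<xi> $ j - \<eta> $ j)
      = (b $ j + \<xi> $ j) * ln ((b $ j + \<xi> $ j) / (b $ j + \<eta> $ j)) - \<xi> $ j + \<eta> $ j" for j
  proof -
    have pos: "b $ j > 0" "b $ j + \<xi> $ j > 0" "b $ j + \<eta> $ j > 0"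
      using b[of j] \<xi>[of j] \<eta>[of j] by simp_all
    show ?thesis
      unfolding ln_divide_pos[OF pos(2,1)] ln_divide_pos[OF pos(3,1)] ln_divide_pos[OF pos(2,3)]
      by algebra
  qed
  then show ?thesis
    unfolding bregman_def bregman_at_def gradient_fenchel_conj_mirror[OF b \<eta>]
      fenchel_conj_mirror[OF b \<xi>] fenchel_conj_mirror[OF b \<eta>]
    by (simp only: ereal_minus(1) inner_vec_def inner_real_def vector_minus_component
        vec_lambda_beta sum_subtractf[symmetric])
qed

section \<open>Row softmax distributions and column sums\<close>

definition partition_fn :: "real^'m^'n \<Rightarrow> real^'m \<Rightarrow> 'n \<Rightarrow> real" where
  "partition_fn C v i = (\<Sum>j\<in>UNIV. exp (v $ j - C $ i $ j))"

definition softmax :: "real^'m^'n \<Rightarrow> real^'m \<Rightarrow> 'n \<Rightarrow> 'm \<Rightarrow> real" where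
  "softmax C v i j = exp (v $ j - C $ i $ j) / partition_fn C v i"

text \<open>For positive \<open>a\<close> these are the column sums of
  \<open>plan C (opt_u a b C v) v\<close>, since
  \<open>exp (opt_u a b C v $ i) = a $ i / partition_fn C v i\<close>.\<close>

definition col_sums :: "real^'n \<Rightarrow> real^'m^'n \<Rightarrow> real^'m \<Rightarrow> real^'m" where
  "col_sums a C v = (\<chi> j. \<Sum>i\<in>UNIV. a $ i * softmax C v i j)"

lemma partition_fn_pos: "partition_fn C v i > 0"
  unfolding partition_fn_def by (intro sum_pos) auto

lemma softmax_pos: "softmax C v i j > 0"
  unfolding softmax_def by (simp add: partition_fn_pos)

lemma sum_softmax: "(\<Sum>j\<in>UNIV. softmax C v i j) = 1"
  using partition_fn_pos[of C v i]
  by (simp add: softmax_def sum_divide_distrib[symmetric] partition_fn_def[symmetric])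

lemma col_sums_pos:
  assumes "\<And>i. a $ i > 0"
  shows "col_sums a C v $ j > 0"
  unfolding col_sums_def by (auto intro!: sum_pos mult_pos_pos assms softmax_pos)

lemma sum_col_sums: "(\<Sum>j\<in>UNIV. col_sums a C v $ j) = (\<Sum>i\<in>UNIV. a $ i)"
proof -
  have "(\<Sum>j\<in>UNIV. col_sums a C v $ j) = (\<Sum>i\<in>UNIV. \<Sum>j\<in>UNIV. a $ i * softmax C v i j)"
    unfolding col_sums_def by (subst sum.swap) simp
  then show ?thesis
    by (simp add: sum_distrib_left[symmetric] sum_softmax)
qed

section \<open>Closed form and gradient of the semi-dual\<close>

text \<open>Optimality in \<open>u\<close> makes the row sums of the plan equal to \<open>a\<close>,
  so its total mass is constant in \<open>v\<close>; the nonlinear dependence on \<open>v\<close>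
  sits in the log-partition functions.\<close>

lemma semi_dual_eq:
  fixes a :: "real^'n" and b :: "real^'m"
  assumes a: "\<And>i. a $ i > 0"
  shows "semi_dual a b C v
    = (\<Sum>i\<in>UNIV. a $ i - a $ i * ln (a $ i)) + (\<Sum>i\<in>UNIV. a $ i * ln (partition_fn C v i)) - v \<bullet> b"
proof -
  have u: "opt_u a b C v $ i = ln (a $ i) - ln (partition_fn C v i)" for i
    by (simp add: opt_u_eq[OF a] partition_fn_def)
  have "(\<Sum>j\<in>UNIV. plan C (opt_u a b C v) v $ i $ j) = a $ i" for i
  proof -
    have "(\<Sum>j\<in>UNIV. plan C (opt_u a b C v) v $ i $ j) = exp (opt_u a b C v $ i) * partition_fn C v i"
      unfolding plan_def partition_fn_def sum_distrib_left
      by (simp add: exp_add[symmetric] add_diff_eq)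
    then show ?thesis
      using a[of i] partition_fn_pos[of C v i] by (simp add: u exp_diff)
  qed
  then show ?thesis
    by (simp add: semi_dual_def dual_obj_def inner_vec_def[of _ a] u sum_subtractf sum.distrib algebra_simps)
qed

lemma gradient_semi_dual:
  fixes a :: "real^'n" and b :: "real^'m"
  assumes a: "\<And>i. a $ i > 0"
  shows "gradient (semi_dual a b C) v = col_sums a C v - b"
proof (rule gradient_eqI)
  have component: "((\<lambda>v. v $ j) has_derivative (\<lambda>h. h $ j)) (at v)" for j
    by (rule bounded_linear_imp_has_derivative[OF bounded_linear_vec_nth])
  have Z: "((\<lambda>v. partition_fn C v i) has_derivative
      (\<lambda>h. \<Sum>j\<in>UNIV. exp (v $ j - C $ i $ j) * h $ j)) (at v)" for i
    unfolding partition_fn_def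
    by (rule has_derivative_sum) (auto intro!: derivative_eq_intros component)
  have lnZ: "((\<lambda>v. a $ i * ln (partition_fn C v i)) has_derivative
      (\<lambda>h. \<Sum>j\<in>UNIV. h $ j * (a $ i * softmax C v i j))) (at v)" for i
  proof -
    have "((\<lambda>v. a $ i * ln (partition_fn C v i)) has_derivative
        (\<lambda>h. a $ i * ((\<Sum>j\<in>UNIV. exp (v $ j - C $ i $ j) * h $ j) * inverse (partition_fn C v i)))) (at v)"
      by (intro has_derivative_mult_right has_derivative_ln Z partition_fn_pos)
    moreover have "a $ i * ((\<Sum>j\<in>UNIV. exp (v $ j - C $ i $ j) * h $ j) * inverse (partition_fn C v i))
        = (\<Sum>j\<in>UNIV. h $ j * (a $ i * softmax C v i j))" for h
      unfolding softmax_def sum_distrib_left sum_distrib_right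
      by (simp add: divide_inverse mult_ac)
    ultimately show ?thesis
      by simp
  qed
  have sw: "(\<Sum>i\<in>UNIV. \<Sum>j\<in>UNIV. h $ j * (a $ i * softmax C v i j)) = h \<bullet> col_sums a C v" for h
    unfolding col_sums_def inner_vec_def
    by (subst sum.swap) (simp add: sum_distrib_left)
  \<comment> \<open>The summand 0 is the derivative of the part of \<open>semi_dual_eq\<close> that
    depends on \<open>a\<close> alone.\<close>
  have "(semi_dual a b C has_derivative
      (\<lambda>h. 0 + (\<Sum>i\<in>UNIV. \<Sum>j\<in>UNIV. h $ j * (a $ i * softmax C v i j)) - h \<bullet> b)) (at v)"
    unfolding semi_dual_eq[OF a, abs_def]
    by (intro has_derivative_diff has_derivative_add has_derivative_const has_derivative_sum lnZ
        bounded_linear_imp_has_derivative bounded_linear_inner_left)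
  then show "GDERIV (semi_dual a b C) v :> col_sums a C v - b"
    by (simp add: gderiv_def sw inner_diff_right)
qed

section \<open>Comparison of the divergences and the conjugate of the semi-dual\<close>

text \<open>The right side equals the \<open>a\<close>-weighted sum of the row divergences between
  \<open>softmax C v i\<close> and \<open>softmax C w i\<close>; merging the rows within each column
  can only decrease divergence.\<close>

lemma kl_col_sums_le:
  fixes a :: "real^'n" and b v w :: "real^'m"
  assumes a: "\<And>i. a $ i > 0"
  shows "(\<Sum>j\<in>UNIV. col_sums a C v $ j * ln (col_sums a C v $ j / col_sums a C w $ j))
    \<le> semi_dual a b C w - semi_dual a b C v - (col_sums a C v - b) \<bullet> (w - v)"
proof -
  let ?p = "softmax C v" and ?q = "softmax C w" and ?Z = "partition_fn C"
  \<comment> \<open>The cost \<open>C $ i $ j\<close> cancels, leaving a term that depends on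
    \<open>j\<close> only and a term that depends on \<open>i\<close> only.\<close>
  have ln_ratio: "ln (?p i j / ?q i j) = v $ j - w $ j + (ln (?Z w i) - ln (?Z v i))" for i j
    using partition_fn_pos[of C v i] partition_fn_pos[of C w i]
    by (simp add: softmax_def ln_divide_pos ln_mult_pos)
  have "(\<Sum>j\<in>UNIV. col_sums a C v $ j * ln (col_sums a C v $ j / col_sums a C w $ j))
      \<le> (\<Sum>j\<in>UNIV. \<Sum>i\<in>UNIV. a $ i * ?p i j * ln ((a $ i * ?p i j) / (a $ i * ?q i j)))"
    unfolding col_sums_def vec_lambda_beta
    by (intro sum_mono log_sum_inequality) (auto simp: a softmax_pos)
  also have "\<dots> = (\<Sum>j\<in>UNIV. \<Sum>i\<in>UNIV. a $ i * ?p i j * (v $ j - w $ j))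
      + (\<Sum>j\<in>UNIV. \<Sum>i\<in>UNIV. a $ i * ?p i j * (ln (?Z w i) - ln (?Z v i)))"
    using a by (simp add: less_imp_neq[symmetric] ln_ratio distrib_left sum.distrib)
  also have "(\<Sum>j\<in>UNIV. \<Sum>i\<in>UNIV. a $ i * ?p i j * (v $ j - w $ j)) = col_sums a C v \<bullet> (v - w)"
    by (simp add: col_sums_def inner_vec_def sum_distrib_right)
  \<comment> \<open>The logarithms do not depend on \<open>j\<close>, so summing over
    \<open>j\<close> first leaves the total 1 of each softmax row.\<close>
  also have "(\<Sum>j\<in>UNIV. \<Sum>i\<in>UNIV. a $ i * ?p i j * (ln (?Z w i) - ln (?Z v i)))
      = (\<Sum>i\<in>UNIV. a $ i * (ln (?Z w i) - ln (?Z v i)))"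
  proof (subst sum.swap, rule sum.cong)
    fix i
    show "(\<Sum>j\<in>UNIV. a $ i * ?p i j * (ln (?Z w i) - ln (?Z v i))) = a $ i * (ln (?Z w i) - ln (?Z v i))"
      by (simp add: sum_distrib_left[symmetric] sum_distrib_right[symmetric] sum_softmax)
  qed simp
  also have "col_sums a C v \<bullet> (v - w) + (\<Sum>i\<in>UNIV. a $ i * (ln (?Z w i) - ln (?Z v i)))
      = semi_dual a b C w - semi_dual a b C v - (col_sums a C v - b) \<bullet> (w - v)"
    by (simp add: semi_dual_eq[OF a] right_diff_distrib sum_subtractf inner_diff_left
        inner_diff_right inner_commute[of b])
  finally show ?thesis .
qed

text \<open>Both column-sum vectors have the same positive total, so the log-sum inequality over all
  columns has \<open>ln 1\<close> on its left side.\<close>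

lemma kl_col_sums_nonneg:
  fixes a :: "real^'n" and v w :: "real^'m"
  assumes a: "\<And>i. a $ i > 0"
  shows "0 \<le> (\<Sum>j\<in>UNIV. col_sums a C v $ j * ln (col_sums a C v $ j / col_sums a C w $ j))"
proof -
  have "(\<Sum>i\<in>UNIV. a $ i) > 0"
    using a by (intro sum_pos) auto
  then show ?thesis
    using log_sum_inequality[of UNIV "($) (col_sums a C v)" "($) (col_sums a C w)"]
    by (simp add: col_sums_pos[OF a] sum_col_sums)
qed

text \<open>The gap in the subgradient inequality is at least a divergence by
  \<open>kl_col_sums_le\<close>, hence nonnegative; this gives the convexity needed for equality in
  Fenchel-Young at \<open>v\<close>.\<close>

lemma fenchel_conj_semi_dual:
  fixes a :: "real^'n" and b v :: "real^'m"
  assumes a: "\<And>i. a $ i > 0"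
  shows "fenchel_conj (semi_dual a b C) (col_sums a C v - b)
    = ereal ((col_sums a C v - b) \<bullet> v - semi_dual a b C v)"
proof (rule fenchel_conj_subgradient)
  fix z
  show "semi_dual a b C v + (col_sums a C v - b) \<bullet> (z - v) \<le> semi_dual a b C z"
    using kl_col_sums_le[OF a, of C v z b] kl_col_sums_nonneg[OF a, of C v z] by linarith
qed

theorem lemma7:
  fixes a :: "real^'n" and b :: "real^'m" and C :: "real^'m^'n"
    and v w \<xi> \<eta> :: "real^'m"
  assumes "\<And>i. a $ i > 0" and "\<And>j. b $ j > 0"
    and "(\<Sum>i\<in>UNIV. a $ i) = 1" and "(\<Sum>j\<in>UNIV. b $ j) = 1"
    and "\<And>i j. C $ i $ j \<ge> 0"
    and "\<xi> = gradient (semi_dual a b C) v"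
    and "\<eta> = gradient (semi_dual a b C) w"
  shows "bregman (fenchel_conj (mirror b)) \<xi> \<eta>
       \<le> bregman_at (fenchel_conj (semi_dual a b C)) w \<xi> \<eta>"
proof -
  note a = assms(1) and b = assms(2)
  let ?c = "col_sums a C v" and ?d = "col_sums a C w"
  have \<xi>: "\<xi> = ?c - b" and \<eta>: "\<eta> = ?d - b"
    using assms(6,7) by (simp_all add: gradient_semi_dual[OF a])
  have "bregman (fenchel_conj (mirror b)) \<xi> \<eta>
      = ereal (\<Sum>j\<in>UNIV. ?c $ j * ln (?c $ j / ?d $ j) - ?c $ j + ?d $ j)"
    by (subst bregman_fenchel_conj_mirror[OF b]) (simp_all add: \<xi> \<eta> col_sums_pos[OF a] algebra_simps)
  \<comment> \<open>The linear terms cancel because \<open>?c\<close> and \<open>?d\<close> have the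
    same total.\<close>
  also have "\<dots> = ereal (\<Sum>j\<in>UNIV. ?c $ j * ln (?c $ j / ?d $ j))"
    unfolding sum.distrib sum_subtractf sum_col_sums by simp
  also have "\<dots> \<le> ereal (semi_dual a b C w - semi_dual a b C v - (?c - b) \<bullet> (w - v))"
    using kl_col_sums_le[OF a] by simp
  \<comment> \<open>Substituting the Fenchel-Young equalities at \<open>v\<close> and
    \<open>w\<close> turns the Bregman distance of the conjugate into that of the semi-dual with the
    points swapped.\<close>
  also have "\<dots> = bregman_at (fenchel_conj (semi_dual a b C)) w \<xi> \<eta>"
    by (simp add: bregman_at_def \<xi> \<eta> fenchel_conj_semi_dual[OF a] inner_diff_left
        inner_diff_right inner_commute)
  finally show ?thesis .
qed

end
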